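(* Let $I\subset S=K[x_1,\ldots,x_n]$ be a squarefree monomial complete intersection, minimally generated by $m$ monomials. Then $$\beta^{n-m+1}_k(S/I)+\beta^{n-m+1}_{n-m+1-k}(S/I)=0\quad\text{for }0\leq k\leq n-m+1.$$
   Context: $K$ is a field and $S=K[x_1,\ldots,x_n]$ is the polynomial ring in $n$ variables over $K$. A squarefree monomial ideal $I$ with minimal monomial generators $u_1,\ldots,u_m$ is a complete intersection if and only if the generators have pairwise disjoint supports (sets of variables dividing them). For $0\le j\le n$, $\alpha_j(S/I)$ denotes the number of squarefree monomials of degree $j$ in $S$ that are not in $I$. For $0\le k\le q\le n$, $$\beta_k^q(S/I)=\sum_{j=0}^k(-1)^{k-j}\binom{q-j}{k-j}\alpha_j(S/I).$$
   Formalization: The formal theorem additionally assumes that every variable divides some minimal generator of I; without this the claim fails, e.g. for I=(x_1) in K[x_1,x_2] with k=0, where the sum equals 1. *)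

theory Defs
  imports Complex_Main "HOL-Library.Poly_Mapping" "HOL-Library.Cardinality"
begin

text \<open>
  The polynomial ring \<open>S\<close> over \<open>'k\<close>, whose variables are the elements of the finite type \<open>'x\<close>;
  the number of variables is \<open>CARD('x)\<close>. A polynomial maps an exponent vector to its coefficient.
\<close>
type_synonym ('x, 'k) mpoly = "('x \<Rightarrow>\<^sub>0 nat) \<Rightarrow>\<^sub>0 'k"

text \<open>Ideals are the submodules of a ring seen as a module over itself.\<close>
definition ideal_generated :: "'a::comm_ring_1 set \<Rightarrow> 'a set" where
  "ideal_generated B = module.span (*) B"

definition regular_sequence :: "'a::comm_ring_1 list \<Rightarrow> bool" where
  "regular_sequence fs \<longleftrightarrow>
     ideal_generated (set fs) \<noteq> UNIV \<and>
     (\<forall>i<length fs. \<forall>g. fs ! i * g \<in> ideal_generated (set (take i fs))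
        \<longrightarrow> g \<in> ideal_generated (set (take i fs)))"

definition complete_intersection :: "'a::comm_ring_1 set \<Rightarrow> bool" where
  "complete_intersection I \<longleftrightarrow> (\<exists>fs. regular_sequence fs \<and> ideal_generated (set fs) = I)"

definition minimally_generates :: "'a::comm_ring_1 set \<Rightarrow> 'a set \<Rightarrow> bool" where
  "minimally_generates U I \<longleftrightarrow>
     ideal_generated U = I \<and> (\<forall>V. V \<subset> U \<longrightarrow> ideal_generated V \<noteq> I)"

definition monom :: "('x \<Rightarrow>\<^sub>0 nat) \<Rightarrow> ('x, 'k::field) mpoly" where
  "monom t = Poly_Mapping.single t 1"

text \<open>
  Variables are used in the hypothesis that each of them divides some generator of \<open>I\<close>. The
  antisymmetry of the numbers \<open>beta\<close> about \<open>n - m + 1\<close> needs it: for \<open>I = (x\<^sub>1)\<close> in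
  \<open>K[x\<^sub>1, x\<^sub>2]\<close>, where \<open>m = 1\<close>, one has \<open>beta I 2 0 + beta I 2 2 = 1\<close>.
\<close>
definition var :: "'x \<Rightarrow> ('x, 'k::field) mpoly" where
  "var x = monom (Poly_Mapping.single x 1)"

definition squarefree_exponent :: "('x \<Rightarrow>\<^sub>0 nat) \<Rightarrow> bool" where
  "squarefree_exponent t \<longleftrightarrow> (\<forall>x. Poly_Mapping.lookup t x \<le> 1)"

definition exponent_degree :: "('x::finite \<Rightarrow>\<^sub>0 nat) \<Rightarrow> nat" where
  "exponent_degree t = (\<Sum>x\<in>UNIV. Poly_Mapping.lookup t x)"

definition squarefree_monomial_ideal :: "('x, 'k::field) mpoly set \<Rightarrow> bool" where
  "squarefree_monomial_ideal I \<longleftrightarrow>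
     (\<exists>T. (\<forall>t\<in>T. squarefree_exponent t) \<and> I = ideal_generated (monom ` T))"

definition alpha :: "('x::finite, 'k::field) mpoly set \<Rightarrow> nat \<Rightarrow> nat" where
  "alpha I j =
     card {u. u \<notin> I \<and> (\<exists>t. u = monom t \<and> squarefree_exponent t \<and> exponent_degree t = j)}"

text \<open>Meant for \<open>k \<le> q\<close>, so that no subtraction below is truncated.\<close>
definition beta :: "('x::finite, 'k::field) mpoly set \<Rightarrow> nat \<Rightarrow> nat \<Rightarrow> int" where
  "beta I q k = (\<Sum>j\<le>k. (-1) ^ (k - j) * int ((q - j) choose (k - j)) * int (alpha I j))"

end

theory Submission
  imports "HOL-Computational_Algebra.Polynomial" Defs
begin

text \<open>
  Let \<open>I\<close> be generated by a regular sequence \<open>f\<close>. The coefficients of a relation between the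
  \<open>f\<^sub>i\<close> lie in \<open>I\<close>. Suppose that \<open>s\<close> and \<open>t\<close> are minimal monomial generators of \<open>I\<close>, and write
  their lcm as \<open>u s = v t\<close>. Expand \<open>s\<close> and \<open>t\<close> in the \<open>f\<^sub>i\<close>: the relation \<open>u s - v t = 0\<close> gives
  elements of \<open>I\<close>, which, re-expanded in the monomial generators, yield
  \<open>u M\<^sub>s\<^sub>s - v M\<^sub>t\<^sub>s \<in> I\<close> where \<open>M\<^sub>s\<^sub>s\<close> has constant coefficient \<open>1\<close>. As \<open>v\<close> does not divide \<open>u\<close>,
  the monomial \<open>u\<close> occurs in this polynomial, so \<open>u \<in> I\<close>. But \<open>u\<close> divides \<open>t\<close>, so \<open>u = t\<close> by
  minimality, and \<open>s\<close> and \<open>t\<close> are coprime.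

  The supports of the generators thus partition the variables into blocks of sizes \<open>d\<^sub>i\<close>, and
  counting the sets that contain no block gives
  \<open>\<Sum>\<^sub>j alpha\<^sub>j X\<^sup>j (1 - X)\<^bsup>n - j\<^esup> = \<Prod>\<^sub>i (1 - X\<^bsup>d\<^sub>i\<^esup>)\<close>. Dividing by \<open>(1 - X)\<^bsup>m - 1\<^esup>\<close> shows
  that the generating polynomial of the numbers \<open>beta\<close> for \<open>q = n - m + 1\<close> is
  \<open>(1 - X) \<Prod>\<^sub>i (1 + X + \<dots> + X\<^bsup>d\<^sub>i - 1\<^esup>)\<close>: a product of palindromic polynomials and of the
  antipalindromic \<open>1 - X\<close>, of total degree \<open>q\<close>.
\<close>

section \<open>Ideals and regular sequences\<close>

interpretation ideal: module "(*) :: 'a::comm_ring_1 \<Rightarrow> 'a \<Rightarrow> 'a"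
  by unfold_locales (simp_all add: algebra_simps)

text \<open>As a simplification rule it loops with \<open>mult.assoc\<close>.\<close>
declare ideal.scale_scale [simp del]

text \<open>Coefficients are indexed by position, not by element, so that expansions and relations
  make sense even for a list with repeated entries.\<close>

lemma ideal_generated_set_iff:
  fixes fs :: "'a::comm_ring_1 list"
  shows "p \<in> ideal_generated (set fs) \<longleftrightarrow> (\<exists>g. p = (\<Sum>i<length fs. g i * fs ! i))"
proof (induction fs arbitrary: p rule: rev_induct)
  case Nil
  then show ?case by (simp add: ideal_generated_def)
next
  case (snoc f fs)
  have "p \<in> ideal_generated (set (fs @ [f])) \<longleftrightarrow> (\<exists>k. p - k * f \<in> ideal_generated (set fs))"
    by (simp add: ideal_generated_def ideal.span_breakdown_eq)
  also have "\<dots> \<longleftrightarrow> (\<exists>k g. p = (\<Sum>i<length fs. g i * fs ! i) + k * f)"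
    by (simp add: snoc.IH algebra_simps)
  also have "\<dots> \<longleftrightarrow> (\<exists>g. p = (\<Sum>i<length (fs @ [f]). g i * (fs @ [f]) ! i))"
  proof safe
    fix k g
    show "\<exists>g'. (\<Sum>i<length fs. g i * fs ! i) + k * f = (\<Sum>i<length (fs @ [f]). g' i * (fs @ [f]) ! i)"
      by (intro exI[of _ "g(length fs := k)"]) (simp add: nth_append)
  qed (auto simp: nth_append)
  finally show ?case .
qed

text \<open>Induction on the last entry \<open>f\<close>: by regularity its coefficient lies in the
  ideal of the earlier entries, say with coefficients \<open>h i\<close>. Substituting this gives a
  relation between the earlier entries with coefficients \<open>g i + h i * f\<close>, which the
  induction hypothesis puts in their ideal; \<open>h i * f\<close> is in the full ideal anyway. The
  regularity condition is assumed in a form that passes directly to prefixes.\<close>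

lemma regular_sequence_syzygy:
  fixes fs :: "'a::comm_ring_1 list"
  assumes "\<And>i g. i < length fs \<Longrightarrow> fs ! i * g \<in> ideal_generated (set (take i fs))
             \<Longrightarrow> g \<in> ideal_generated (set (take i fs))"
    and "(\<Sum>i<length fs. g i * fs ! i) = 0" and "i < length fs"
  shows "g i \<in> ideal_generated (set fs)"
  using assms
proof (induction fs arbitrary: g i rule: rev_induct)
  case Nil
  then show ?case by simp
next
  case (snoc f fs)
  have mono: "h \<in> ideal_generated (set fs) \<Longrightarrow> h \<in> ideal_generated (set (fs @ [f]))" for h
    unfolding ideal_generated_def using ideal.span_mono[of "set fs" "set (fs @ [f])"] by auto
  have sum0: "(\<Sum>i<length fs. g i * fs ! i) + g (length fs) * f = 0"
    using snoc.prems(2) by (simp add: nth_append)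
  then have "f * g (length fs) = (\<Sum>i<length fs. - g i * fs ! i)"
    by (simp add: sum_negf algebra_simps add_eq_0_iff)
  then have "f * g (length fs) \<in> ideal_generated (set fs)"
    unfolding ideal_generated_set_iff by (rule exI[where P = "\<lambda>g'. _ = (\<Sum>i<length fs. g' i * fs ! i)"])
  then have last: "g (length fs) \<in> ideal_generated (set fs)"
    using snoc.prems(1)[of "length fs" "g (length fs)"] by simp
  then obtain h where h: "g (length fs) = (\<Sum>i<length fs. h i * fs ! i)"
    by (auto simp: ideal_generated_set_iff)
  show ?case
  proof (cases "i < length fs")
    case True
    have "(g i + h i * f) * fs ! i = g i * fs ! i + h i * fs ! i * f" for i
      by (simp add: algebra_simps)
    then have "(\<Sum>i<length fs. (g i + h i * f) * fs ! i)
        = (\<Sum>i<length fs. g i * fs ! i) + (\<Sum>i<length fs. h i * fs ! i) * f"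
      by (simp only: sum.distrib sum_distrib_right)
    also have "\<dots> = 0"
      using sum0 unfolding h .
    finally have "(\<Sum>i<length fs. (g i + h i * f) * fs ! i) = 0" .
    then have "g i + h i * f \<in> ideal_generated (set fs)"
    proof (rule snoc.IH[where g = "\<lambda>i. g i + h i * f", rotated])
      fix j g'
      assume "j < length fs" "fs ! j * g' \<in> ideal_generated (set (take j fs))"
      then show "g' \<in> ideal_generated (set (take j fs))"
        using snoc.prems(1)[of j g'] by (simp add: nth_append)
    qed (use True in auto)
    then have "g i + h i * f \<in> ideal_generated (set (fs @ [f]))"
      by (rule mono)
    moreover have "h i * f \<in> ideal_generated (set (fs @ [f]))"
      unfolding ideal_generated_def by (intro ideal.span_scale ideal.span_base) simp
    ultimately have "g i + h i * f - h i * f \<in> ideal_generated (set (fs @ [f]))"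
      unfolding ideal_generated_def by (rule ideal.span_diff)
    then show ?thesis by simp
  next
    case False
    with snoc.prems(3) have "i = length fs" by simp
    with last mono show ?thesis by blast
  qed
qed

section \<open>Monomial ideals\<close>

abbreviation divides_exponent :: "('x \<Rightarrow>\<^sub>0 nat) \<Rightarrow> ('x \<Rightarrow>\<^sub>0 nat) \<Rightarrow> bool"  (infix "\<preceq>" 50) where
  "s \<preceq> t \<equiv> \<forall>x. Poly_Mapping.lookup s x \<le> Poly_Mapping.lookup t x"

lemma divides_exponent_iff: "s \<preceq> t \<longleftrightarrow> (\<exists>r. t = s + r)"
proof
  assume "s \<preceq> t"
  then have "t = s + (t - s)"
    by (intro poly_mapping_eqI) (simp add: lookup_add lookup_minus)
  then show "\<exists>r. t = s + r" ..
qed (auto simp: lookup_add)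

lemma divides_exponent_antisym: "s \<preceq> t \<Longrightarrow> t \<preceq> s \<Longrightarrow> s = t"
  by (intro poly_mapping_eqI) (simp add: order_antisym)

lemma divides_exponent_trans: "r \<preceq> s \<Longrightarrow> s \<preceq> t \<Longrightarrow> r \<preceq> t"
  by (meson order_trans)

lemma monom_add: "(monom (s + t) :: ('x, 'k::field) mpoly) = monom s * monom t"
  by (simp add: monom_def mult_single)

lemma inj_monom: "inj (monom :: ('x \<Rightarrow>\<^sub>0 nat) \<Rightarrow> ('x, 'k::field) mpoly)"
proof (rule injI)
  fix s t :: "'x \<Rightarrow>\<^sub>0 nat"
  assume "(monom s :: ('x, 'k) mpoly) = monom t"
  then have "Poly_Mapping.keys (monom s :: ('x, 'k) mpoly) = Poly_Mapping.keys (monom t :: ('x, 'k) mpoly)"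
    by simp
  then show "s = t" by (simp add: monom_def)
qed

lemma lookup_monom_times:
  "Poly_Mapping.lookup (monom s * p :: ('x, 'k::field) mpoly) (s + t) = Poly_Mapping.lookup p t"
proof -
  have "Poly_Mapping.lookup (monom s * p) (s + t) =
    (\<Sum>l. Poly_Mapping.lookup (monom s :: ('x, 'k) mpoly) l *
      (\<Sum>q. (Poly_Mapping.lookup p q when s + t = l + q)))"
    by (simp add: lookup_mult)
  also have "\<dots> = (\<Sum>l. ((\<Sum>q. (Poly_Mapping.lookup p q when s + t = l + q)) when l = s))"
    by (intro Sum_any.cong) (auto simp: monom_def lookup_single when_def)
  also have "\<dots> = (\<Sum>q. (Poly_Mapping.lookup p q when q = t))"
    by (auto intro!: Sum_any.cong simp: when_def)
  finally show ?thesis by simp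
qed

lemma lookup_monom_times_nonzero:
  fixes p :: "('x, 'k::field) mpoly"
  assumes "Poly_Mapping.lookup (monom s * p) t \<noteq> 0"
  shows "s \<preceq> t"
proof -
  have "t \<in> Poly_Mapping.keys (monom s * p)"
    using assms by (simp add: in_keys_iff)
  then have "\<exists>r. t = s + r"
    using keys_mult[of "monom s" p] by (auto simp: monom_def split: if_splits)
  then show ?thesis by (simp add: divides_exponent_iff)
qed

text \<open>A multiple of \<open>monom s\<close> has only exponents that \<open>s\<close> divides,
  and adding polynomials creates no new exponents.\<close>

lemma ideal_generated_monom_nonzero:
  fixes p :: "('x, 'k::field) mpoly"
  assumes "p \<in> ideal_generated (monom ` T)" and "Poly_Mapping.lookup p t \<noteq> 0"
  shows "\<exists>s\<in>T. s \<preceq> t"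
  using assms unfolding ideal_generated_def
proof (induction arbitrary: t rule: ideal.span_induct_alt)
  case (step c x y)
  then obtain s where s: "s \<in> T" "x = monom s" by auto
  have "Poly_Mapping.lookup (monom s * c) t \<noteq> 0 \<or> Poly_Mapping.lookup y t \<noteq> 0"
    using step.prems s by (auto simp: lookup_add mult.commute)
  then show ?case
    using s step.IH lookup_monom_times_nonzero by blast
qed simp

lemma monom_in_ideal_generated:
  "(monom t :: ('x, 'k::field) mpoly) \<in> ideal_generated (monom ` T) \<longleftrightarrow> (\<exists>s\<in>T. s \<preceq> t)"
proof
  assume "(monom t :: ('x, 'k) mpoly) \<in> ideal_generated (monom ` T)"
  then show "\<exists>s\<in>T. s \<preceq> t"
    by (rule ideal_generated_monom_nonzero) (simp add: monom_def)
next
  assume "\<exists>s\<in>T. s \<preceq> t"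
  then obtain s r where "s \<in> T" "t = s + r"
    by (auto simp: divides_exponent_iff)
  then have "monom t = (monom r * monom s :: ('x, 'k) mpoly)" "s \<in> T"
    by (simp_all add: monom_add mult.commute)
  then show "(monom t :: ('x, 'k) mpoly) \<in> ideal_generated (monom ` T)"
    unfolding ideal_generated_def by (simp add: ideal.span_scale ideal.span_base)
qed

lemma minimally_generates_antichain:
  fixes I :: "('x, 'k::field) mpoly set"
  assumes "minimally_generates (monom ` E) I" "s \<in> E" "t \<in> E" "s \<preceq> t"
  shows "s = t"
proof (rule ccontr)
  assume "s \<noteq> t"
  let ?V = "monom ` (E - {t}) :: ('x, 'k) mpoly set"
  have "monom t \<in> ideal_generated ?V"
    using assms \<open>s \<noteq> t\<close> by (subst monom_in_ideal_generated) auto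
  then have "monom ` E \<subseteq> ideal_generated ?V"
    unfolding ideal_generated_def by (auto intro: ideal.span_base)
  moreover have "?V \<subseteq> ideal_generated (monom ` E)"
    unfolding ideal_generated_def by (auto intro: ideal.span_base)
  ultimately have "ideal_generated ?V = ideal_generated (monom ` E)"
    unfolding ideal_generated_def ideal.span_eq by simp
  then have "ideal_generated ?V = I"
    using assms(1) by (simp add: minimally_generates_def)
  moreover have "?V \<subset> monom ` E"
    using assms(3) inj_monom by (auto simp: inj_image_mem_iff dest: injD)
  ultimately show False
    using assms(1) by (auto simp: minimally_generates_def)
qed

text \<open>Some squarefree generator \<open>t\<close> divides \<open>e\<close>, and some
  \<open>e'\<close> in \<open>E\<close> divides \<open>t\<close>. Then \<open>e'\<close> divides
  \<open>e\<close>, so the antichain property squeezes all three together.\<close>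

lemma minimally_generates_squarefree:
  fixes I :: "('x, 'k::field) mpoly set"
  assumes "minimally_generates (monom ` E) I" "squarefree_monomial_ideal I" "e \<in> E"
  shows "squarefree_exponent e"
proof -
  from assms(2) obtain T where T: "\<And>t. t \<in> T \<Longrightarrow> squarefree_exponent t"
    "I = ideal_generated (monom ` T)"
    by (auto simp: squarefree_monomial_ideal_def)
  have E: "I = ideal_generated (monom ` E)"
    using assms(1) by (simp add: minimally_generates_def)
  have "monom e \<in> I"
    using assms(3) by (auto simp: E monom_in_ideal_generated)
  then obtain t where t: "t \<in> T" "t \<preceq> e"
    by (auto simp: T(2) monom_in_ideal_generated)
  have "monom t \<in> I"
    using t by (auto simp: T(2) monom_in_ideal_generated)
  then obtain e' where e': "e' \<in> E" "e' \<preceq> t"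
    by (auto simp: E monom_in_ideal_generated)
  then have "e' = e"
    using minimally_generates_antichain[OF assms(1)] assms(3) t divides_exponent_trans by blast
  then show ?thesis
    using e' t T(1) divides_exponent_antisym by blast
qed

section \<open>Coprimality of the minimal generators of a complete intersection\<close>

lemma complete_intersection_disjoint:
  fixes I :: "('x, 'k::field) mpoly set"
  assumes "complete_intersection I" and gen: "minimally_generates (monom ` E) I" and "finite E"
    and s: "s \<in> E" and t: "t \<in> E" and "s \<noteq> t"
  shows "Poly_Mapping.keys s \<inter> Poly_Mapping.keys t = {}"
proof -
  let ?c = "Poly_Mapping.lookup :: ('x, 'k) mpoly \<Rightarrow> _"
  from assms(1) obtain fs where fs: "regular_sequence fs" "ideal_generated (set fs) = I"
    by (auto simp: complete_intersection_def)
  have I: "I = ideal_generated (monom ` E)"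
    using gen by (simp add: minimally_generates_def)
  note antichain = minimally_generates_antichain[OF gen]
  have "\<exists>g. monom e = (\<Sum>i<length fs. g i * fs ! i)" if "e \<in> E" for e
  proof -
    have "monom e \<in> I"
      using that by (auto simp: I monom_in_ideal_generated)
    then show ?thesis
      by (simp add: fs(2)[symmetric] ideal_generated_set_iff)
  qed
  then obtain b where b: "\<And>e. e \<in> E \<Longrightarrow> monom e = (\<Sum>i<length fs. b e i * fs ! i)"
    by metis
  have "\<exists>g. fs ! i = (\<Sum>e\<in>E. g e * monom e)" if "i < length fs" for i
  proof -
    have "fs ! i \<in> ideal_generated (monom ` E)"
      using that ideal.span_base[of "fs ! i" "set fs"] fs(2) I
      by (simp add: ideal_generated_def)
    then obtain g where "fs ! i = (\<Sum>v\<in>monom ` E. g v * v)"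
      using \<open>finite E\<close> by (auto simp: ideal_generated_def ideal.span_finite)
    also have "\<dots> = (\<Sum>e\<in>E. g (monom e) * monom e)"
      by (subst sum.reindex) (use inj_monom in \<open>auto intro: inj_on_subset\<close>)
    finally show ?thesis
      by (rule exI[of _ "\<lambda>e. g (monom e)"])
  qed
  then obtain a where a: "\<And>i. i < length fs \<Longrightarrow> fs ! i = (\<Sum>e\<in>E. a i e * monom e)"
    by metis
  \<comment> \<open>Expanding a generator in \<open>fs\<close> and then \<open>fs\<close> back in
    the generators gives a matrix that fixes the vector of generators.\<close>
  define M where "M e e' = (\<Sum>i<length fs. b e i * a i e')" for e e'
  have M: "monom e = (\<Sum>e'\<in>E. M e e' * monom e')" if "e \<in> E" for e
  proof -
    have "monom e = (\<Sum>i<length fs. \<Sum>e'\<in>E. b e i * (a i e' * monom e'))"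
      unfolding b[OF that] by (intro sum.cong refl) (simp only: a lessThan_iff sum_distrib_left)
    also have "\<dots> = (\<Sum>e'\<in>E. M e e' * monom e')"
      unfolding M_def by (subst sum.swap) (simp add: sum_distrib_right mult.assoc)
    finally show ?thesis .
  qed
  \<comment> \<open>Compare coefficients at \<open>s\<close>: no other generator divides
    \<open>s\<close>, so only the summand for \<open>s\<close> contributes.\<close>
  have const: "?c (M s s) 0 = 1"
  proof -
    have "1 = ?c (monom s) s"
      by (simp add: monom_def)
    also have "\<dots> = (\<Sum>e'\<in>E. ?c (monom e' * M s e') s)"
      by (subst M[OF s]) (simp add: lookup_sum mult.commute)
    also have "\<dots> = (\<Sum>e'\<in>{s}. ?c (monom e' * M s e') s)"
      using \<open>finite E\<close> s antichain lookup_monom_times_nonzero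
      by (intro sum.mono_neutral_right) blast+
    also have "\<dots> = ?c (M s s) 0"
      using lookup_monom_times[of s "M s s" 0] by simp
    finally show ?thesis by simp
  qed

  \<comment> \<open>Subtraction of exponents is truncated at 0, so \<open>u\<close> and
    \<open>v\<close> are the cofactors of \<open>s\<close> and \<open>t\<close> in their
    lcm.\<close>
  define u v where "u = t - s" and "v = s - t"
  have "u + s = v + t"
    by (intro poly_mapping_eqI) (simp add: u_def v_def lookup_add lookup_minus)
  then have "monom u * monom s = monom v * (monom t :: ('x, 'k) mpoly)"
    by (simp flip: monom_add)
  then have "(\<Sum>i<length fs. (monom u * b s i - monom v * b t i) * fs ! i) = 0"
    unfolding b[OF s] b[OF t]
    by (simp add: sum_distrib_left left_diff_distrib sum_subtractf mult.assoc)
  then have syz: "monom u * b s i - monom v * b t i \<in> I" if "i < length fs" for i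
    unfolding fs(2)[symmetric]
    using regular_sequence_syzygy[of fs "\<lambda>i. monom u * b s i - monom v * b t i"] fs(1) that
    unfolding regular_sequence_def by blast
  have "monom u * M s s - monom v * M t s
    = (\<Sum>i<length fs. a i s * (monom u * b s i - monom v * b t i))"
    by (simp add: M_def sum_distrib_left sum_subtractf algebra_simps)
  also have "\<dots> \<in> I"
    using syz unfolding I ideal_generated_def by (intro ideal.span_sum ideal.span_scale) auto
  finally have mem: "monom u * M s s - monom v * M t s \<in> ideal_generated (monom ` E)"
    by (simp add: I)
  \<comment> \<open>At each variable \<open>u\<close> or \<open>v\<close> vanishes, so
    \<open>v\<close> dividing \<open>u\<close> would mean that \<open>v\<close> is 0 and
    \<open>s\<close> divides \<open>t\<close>.\<close>
  have "?c (monom v * M t s) u = 0"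
  proof (rule ccontr)
    assume "?c (monom v * M t s) u \<noteq> 0"
    then have le: "v \<preceq> u"
      by (rule lookup_monom_times_nonzero)
    have "s \<preceq> t"
    proof
      fix x
      show "Poly_Mapping.lookup s x \<le> Poly_Mapping.lookup t x"
        using le[rule_format, of x] by (simp add: u_def v_def lookup_minus)
    qed
    then show False
      using antichain s t \<open>s \<noteq> t\<close> by blast
  qed
  then have "?c (monom u * M s s - monom v * M t s) u = 1"
    using const lookup_monom_times[of u "M s s" 0] by (simp add: lookup_minus)
  then obtain e where e: "e \<in> E" "e \<preceq> u"
    using ideal_generated_monom_nonzero[OF mem, of u] by auto
  have "u \<preceq> t"
    by (simp add: u_def lookup_minus)
  then have "e = t"
    using antichain e t divides_exponent_trans by blast
  \<comment> \<open>With truncated subtraction this inequality holds at a variable only if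
    \<open>s\<close> or \<open>t\<close> is 0 there.\<close>
  then have "t \<preceq> t - s"
    using e by (simp add: u_def)
  then have "Poly_Mapping.lookup t x = 0 \<or> Poly_Mapping.lookup s x = 0" for x
    by (metis diff_less lookup_minus neq0_conv not_le)
  then show ?thesis
    by (auto simp: in_keys_iff)
qed

section \<open>Subsets avoiding the blocks of a partition\<close>

lemma sum_Pow_weight:
  fixes a b :: "'c::comm_ring_1"
  assumes "finite A"
  shows "(\<Sum>S\<in>Pow A. a ^ card S * b ^ card (A - S)) = (a + b) ^ card A"
  using prod_add[OF assms, of "\<lambda>_. a" "\<lambda>_. b"] by simp

text \<open>The weight is multiplicative over disjoint blocks, and a set avoids all blocks iff its
  trace on each block \<open>B\<close> is a proper subset. Each block thus contributes the full
  binomial sum minus the term of \<open>B\<close> itself.\<close>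

lemma sum_avoiding_weight:
  fixes a b :: "'c::comm_ring_1"
  assumes "finite P" "\<And>B. B \<in> P \<Longrightarrow> finite B" "pairwise disjnt P"
  shows "(\<Sum>S | S \<subseteq> \<Union>P \<and> (\<forall>B\<in>P. \<not> B \<subseteq> S). a ^ card S * b ^ card (\<Union>P - S))
       = (\<Prod>B\<in>P. (a + b) ^ card B - a ^ card B)"
  using assms
proof (induction P rule: finite_induct)
  case empty
  have "{S. S = {}} = {{}}" by auto
  then show ?case by simp
next
  case (insert B P)
  let ?A = "\<Union>P"
  let ?w = "\<lambda>A S. a ^ card S * b ^ card (A - S)"
  let ?avoid = "{S. S \<subseteq> ?A \<and> (\<forall>C\<in>P. \<not> C \<subseteq> S)}"
  have fin: "finite B" "finite ?A"
    using insert by auto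
  have dis: "B \<inter> ?A = {}"
    using insert.prems(2) insert.hyps(2) by (fastforce simp: pairwise_insert disjnt_def)
  have w: "?w B S * ?w ?A T = ?w (B \<union> ?A) (S \<union> T)" if "S \<subseteq> B" "T \<subseteq> ?A" for S T
  proof -
    have "card (S \<union> T) = card S + card T"
      using that dis fin by (intro card_Un_disjoint) (auto intro: finite_subset)
    moreover have "(B \<union> ?A) - (S \<union> T) = (B - S) \<union> (?A - T)"
      using that dis by blast
    moreover have "card ((B - S) \<union> (?A - T)) = card (B - S) + card (?A - T)"
      using dis fin by (intro card_Un_disjoint) auto
    ultimately show ?thesis
      by (simp add: power_add algebra_simps)
  qed
  have "(\<Sum>S\<in>Pow B - {B}. ?w B S) = (a + b) ^ card B - a ^ card B"
    using sum_Pow_weight[OF fin(1), of a b] fin(1) by (simp add: sum_diff1)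
  moreover have "(\<Sum>T\<in>?avoid. ?w ?A T) = (\<Prod>B\<in>P. (a + b) ^ card B - a ^ card B)"
    using insert by (simp add: pairwise_insert)
  ultimately have "(\<Prod>B\<in>insert B P. (a + b) ^ card B - a ^ card B)
      = (\<Sum>S\<in>Pow B - {B}. ?w B S) * (\<Sum>T\<in>?avoid. ?w ?A T)"
    using insert.hyps by simp
  also have "\<dots> = (\<Sum>(S, T)\<in>(Pow B - {B}) \<times> ?avoid. ?w B S * ?w ?A T)"
    by (simp add: sum_product sum.cartesian_product)
  also have "\<dots> = (\<Sum>(S, T)\<in>(Pow B - {B}) \<times> ?avoid. ?w (B \<union> ?A) (S \<union> T))"
    by (intro sum.cong refl) (auto simp: w)
  also have "\<dots> = (\<Sum>S | S \<subseteq> \<Union>(insert B P) \<and> (\<forall>C\<in>insert B P. \<not> C \<subseteq> S). ?w (\<Union>(insert B P)) S)"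
  proof (rule sum.reindex_bij_witness[where i = "\<lambda>S. (S \<inter> B, S \<inter> ?A)" and j = "\<lambda>(S, T). S \<union> T"])
    fix p assume "p \<in> (Pow B - {B}) \<times> ?avoid"
    then obtain S T where p: "p = (S, T)" "S \<subseteq> B" "S \<noteq> B" "T \<subseteq> ?A" "\<forall>C\<in>P. \<not> C \<subseteq> T"
      by auto
    have "(S \<union> T) \<inter> B = S" "(S \<union> T) \<inter> ?A = T"
      using p dis by blast+
    then show "((case p of (S, T) \<Rightarrow> S \<union> T) \<inter> B, (case p of (S, T) \<Rightarrow> S \<union> T) \<inter> ?A) = p"
      using p by simp
    have "\<not> B \<subseteq> S \<union> T"
      using p dis by blast
    moreover have "\<not> C \<subseteq> S \<union> T" if "C \<in> P" for C
    proof
      assume "C \<subseteq> S \<union> T"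
      then have "C \<subseteq> T" using that p(2) dis by blast
      then show False using that p(5) by blast
    qed
    ultimately show "(case p of (S, T) \<Rightarrow> S \<union> T) \<in>
        {S. S \<subseteq> \<Union>(insert B P) \<and> (\<forall>C\<in>insert B P. \<not> C \<subseteq> S)}"
      using p by auto
  qed auto
  finally show ?case by simp
qed

definition num_avoiding :: "'x::finite set set \<Rightarrow> nat \<Rightarrow> nat" where
  "num_avoiding P j = card {S. card S = j \<and> (\<forall>B\<in>P. \<not> B \<subseteq> S)}"

text \<open>Each block has an element outside \<open>S\<close>, and disjointness makes these
  elements distinct.\<close>

lemma card_avoiding_le:
  fixes P :: "'x::finite set set"
  assumes "pairwise disjnt P" "\<forall>B\<in>P. \<not> B \<subseteq> S"
  shows "card S + card P \<le> CARD('x)"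
proof -
  have "card P = (\<Sum>B\<in>P. 1)" by simp
  also have "\<dots> \<le> (\<Sum>B\<in>P. card (B - S))"
    using assms(2) by (intro sum_mono) (auto simp: Suc_le_eq card_gt_0_iff)
  also have "\<dots> = card (\<Union>B\<in>P. B - S)"
    using assms(1) by (intro card_UN_disjoint [symmetric]) (auto simp: pairwise_def disjnt_def)
  also have "\<dots> \<le> card (- S)"
    by (intro card_mono) auto
  also have "\<dots> = CARD('x) - card S"
    by (simp add: Compl_eq_Diff_UNIV card_Diff_subset)
  finally show ?thesis
    using card_mono[of UNIV S] by simp
qed

section \<open>The generating polynomial of the beta numbers and its antisymmetry\<close>

text \<open>The signed binomials in the definition of \<open>beta\<close> are these coefficients;
  the value 0 for \<open>j > k\<close> explains why that sum stops at \<open>k\<close>.\<close>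

lemma coeff_X_power_times_one_minus_X_power:
  assumes "k \<le> q"
  shows "coeff ([:0, 1:] ^ j * [:1, -1:] ^ (q - j)) k =
    (if j \<le> k then (-1) ^ (k - j) * int ((q - j) choose (k - j)) else 0)"
proof -
  have "[:0, 1:] ^ j = Polynomial.monom (1::int) j"
    by (simp add: monom_altdef)
  then show ?thesis
    using assms by (simp add: coeff_monom_mult coeff_linear_poly_power)
qed

lemma reflect_poly_geometric_sum:
  fixes X :: "int poly"
  defines "X \<equiv> [:0, 1:]"
  assumes "d > 0"
  shows "(\<Sum>i<d. X ^ i) \<noteq> 0" "degree (\<Sum>i<d. X ^ i) = d - 1"
    "reflect_poly (\<Sum>i<d. X ^ i) = (\<Sum>i<d. X ^ i)"
proof -
  have coeff: "coeff (\<Sum>i<d. X ^ i) k = (if k < d then 1 else 0)" for k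
  proof -
    have "X ^ i = Polynomial.monom (1::int) i" for i
      by (simp add: X_def monom_altdef)
    then show ?thesis
      by (simp add: coeff_sum)
  qed
  show "(\<Sum>i<d. X ^ i) \<noteq> 0"
    using coeff[of 0] assms(2) by auto
  show deg: "degree (\<Sum>i<d. X ^ i) = d - 1"
    using assms(2) by (intro order_antisym degree_le le_degree) (auto simp: coeff)
  show "reflect_poly (\<Sum>i<d. X ^ i) = (\<Sum>i<d. X ^ i)"
    using assms(2) by (intro poly_eqI) (auto simp: coeff_reflect_poly deg coeff)
qed

lemma num_avoiding_antisymmetric:
  fixes P :: "'x::finite set set"
  assumes dis: "pairwise disjnt P" and cover: "\<Union>P = UNIV" and ne: "{} \<notin> P"
    and q: "q = CARD('x) - card P + 1" and k: "k \<le> q"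
  defines "h \<equiv> \<lambda>k. \<Sum>j\<le>k. (-1) ^ (k - j) * int ((q - j) choose (k - j)) * int (num_avoiding P j)"
  shows "h k + h (q - k) = 0"
proof -
  define X Y :: "int poly" where "X = [:0, 1:]" and "Y = [:1, -1:]"
  define F where "F = (\<Sum>j\<le>q. of_nat (num_avoiding P j) * (X ^ j * Y ^ (q - j)))"
  have XY: "X + Y = 1" and Y: "Y = 1 - X"
    by (simp_all add: X_def Y_def one_pCons)
  have fin: "finite P" by simp
  have "P \<noteq> {}" using cover by auto
  then have m: "card P > 0" by (simp add: card_gt_0_iff)
  have le: "card P \<le> CARD('x)"
    using card_avoiding_le[OF dis, of "{}"] ne by auto
  \<comment> \<open>The subtractions are exact because there is at least one block and there are at
    most as many blocks as variables.\<close>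
  have n: "CARD('x) = q + (card P - 1)"
    using m le by (simp add: q)

  have coeffF: "coeff F k' = h k'" if "k' \<le> q" for k'
  proof -
    have "coeff F k' = (\<Sum>j\<le>q. int (num_avoiding P j) * coeff (X ^ j * Y ^ (q - j)) k')"
      by (simp add: F_def coeff_sum of_nat_poly)
    also have "\<dots> = (\<Sum>j\<le>q. if j \<le> k' then (-1) ^ (k' - j) * int ((q - j) choose (k' - j))
        * int (num_avoiding P j) else 0)"
      unfolding X_def Y_def using that
      by (intro sum.cong refl) (simp add: coeff_X_power_times_one_minus_X_power)
    also have "\<dots> = h k'"
      unfolding h_def using that by (intro sum.mono_neutral_cong_right) auto
    finally show ?thesis .
  qed

  let ?avoid = "{S. \<forall>B\<in>P. \<not> B \<subseteq> S}"
  \<comment> \<open>This factor raises the exponent of \<open>Y\<close> from \<open>q - j\<close> to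
    \<open>CARD('x) - j\<close>, the size of the complement of a set of size
    \<open>j\<close>.\<close>
  have "Y ^ (card P - 1) * F = (\<Sum>j\<le>q. of_nat (num_avoiding P j) * (X ^ j * Y ^ (CARD('x) - j)))"
    unfolding F_def sum_distrib_left n
    by (intro sum.cong refl) (simp add: algebra_simps flip: power_add)
  also have "\<dots> = (\<Sum>j\<le>q. \<Sum>S | S \<in> ?avoid \<and> card S = j. X ^ card S * Y ^ (CARD('x) - card S))"
    by (intro sum.cong refl) (simp add: num_avoiding_def conj_commute)
  \<comment> \<open>Stopping at \<open>q\<close> loses no set, since an avoiding set has at most
    \<open>CARD('x) - card P\<close> elements.\<close>
  also have "\<dots> = (\<Sum>S\<in>?avoid. X ^ card S * Y ^ (CARD('x) - card S))"
    using card_avoiding_le[OF dis] by (intro sum.group) (fastforce simp: q)+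
  also have "\<dots> = (\<Sum>S | S \<subseteq> \<Union>P \<and> (\<forall>B\<in>P. \<not> B \<subseteq> S). X ^ card S * Y ^ card (\<Union>P - S))"
    by (simp add: cover card_Diff_subset)
  also have "\<dots> = (\<Prod>B\<in>P. 1 - X ^ card B)"
    using sum_avoiding_weight[OF fin _ dis, of X Y] by (simp add: XY)
  also have "\<dots> = Y ^ card P * (\<Prod>B\<in>P. \<Sum>i<card B. X ^ i)"
    by (simp add: one_diff_power_eq Y prod.distrib)
  also have "\<dots> = Y ^ (card P - 1) * (Y * (\<Prod>B\<in>P. \<Sum>i<card B. X ^ i))"
    using m by (metis Suc_pred' mult.assoc power_Suc2)
  \<comment> \<open>The common power of \<open>Y\<close> cancels because integer polynomials form a
    domain.\<close>
  finally have F: "F = Y * (\<Prod>B\<in>P. \<Sum>i<card B. X ^ i)"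
    by (simp add: Y_def)

  have pos: "card B > 0" if "B \<in> P" for B
    using that ne by (metis card_gt_0_iff finite)
  have nz: "(\<Sum>i<card B. X ^ i) \<noteq> 0" if "B \<in> P" for B
    using reflect_poly_geometric_sum(1)[of "card B"] pos[OF that] by (simp add: X_def)
  have "degree F = 1 + (\<Sum>B\<in>P. card B - 1)"
    unfolding F using nz pos reflect_poly_geometric_sum(2)
    by (subst degree_mult_eq) (auto simp: Y_def X_def degree_prod_eq_sum_degree)
  also have "(\<Sum>B\<in>P. card B - 1) = (\<Sum>B\<in>P. card B) - card P"
    using pos by (subst sum_subtractf_nat) (auto simp: Suc_le_eq)
  also have "(\<Sum>B\<in>P. card B) = CARD('x)"
    using card_Union_disjoint[OF dis] by (simp add: cover)
  \<comment> \<open>The degree must be exactly \<open>q\<close> for reflection to exchange the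
    coefficients at \<open>k\<close> and \<open>q - k\<close>.\<close>
  finally have deg: "degree F = q"
    by (simp add: q)
  have "reflect_poly Y = - Y"
    by (simp add: Y_def reflect_poly_pCons)
  then have "reflect_poly F = - F"
    using pos reflect_poly_geometric_sum(3)
    by (simp add: F reflect_poly_mult reflect_poly_prod X_def)
  then have "coeff (reflect_poly F) k = - coeff F k"
    by simp
  then show ?thesis
    using k by (simp add: coeff_reflect_poly deg coeffF)
qed

section \<open>Squarefree monomials outside a monomial ideal\<close>

lemma squarefree_exponent_lookup:
  assumes "squarefree_exponent t"
  shows "Poly_Mapping.lookup t x = (if x \<in> Poly_Mapping.keys t then 1 else 0)"
  using assms unfolding squarefree_exponent_def in_keys_iff
  by (metis One_nat_def le_Suc_eq le_zero_eq)

text \<open>Squarefree monomials correspond to their supports: degree becomes cardinality and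
  divisibility becomes inclusion.\<close>

lemma alpha_eq_num_avoiding:
  fixes E :: "('x::finite \<Rightarrow>\<^sub>0 nat) set"
  assumes sqf: "\<And>e. e \<in> E \<Longrightarrow> squarefree_exponent e"
  shows "alpha (ideal_generated (monom ` E) :: ('x, 'k::field) mpoly set) j
       = num_avoiding (Poly_Mapping.keys ` E) j"
proof -
  let ?T = "{t :: 'x \<Rightarrow>\<^sub>0 nat. squarefree_exponent t \<and> exponent_degree t = j \<and> \<not> (\<exists>e\<in>E. e \<preceq> t)}"
  let ?S = "{S. card S = j \<and> (\<forall>B\<in>Poly_Mapping.keys ` E. \<not> B \<subseteq> S)}"
  have le: "e \<preceq> t \<longleftrightarrow> Poly_Mapping.keys e \<subseteq> Poly_Mapping.keys t"
    if "squarefree_exponent e" "squarefree_exponent t" for e t :: "'x \<Rightarrow>\<^sub>0 nat"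
    using that by (auto simp: squarefree_exponent_lookup)
  have deg: "exponent_degree t = card (Poly_Mapping.keys t)"
    if "squarefree_exponent t" for t :: "'x \<Rightarrow>\<^sub>0 nat"
    using that by (simp add: exponent_degree_def squarefree_exponent_lookup sum.If_cases)
  have "alpha (ideal_generated (monom ` E) :: ('x, 'k) mpoly set) j
      = card (monom ` ?T :: ('x, 'k) mpoly set)"
    unfolding alpha_def by (rule arg_cong[where f = card]) (auto simp: monom_in_ideal_generated, blast)
  also have "\<dots> = card ?T"
    by (intro card_image inj_on_subset[OF inj_monom]) simp
  also have "\<dots> = card ?S"
  proof (rule bij_betw_same_card[of Poly_Mapping.keys], rule bij_betw_imageI)
    show "inj_on Poly_Mapping.keys ?T"
    proof (rule inj_onI)
      fix s t assume "s \<in> ?T" "t \<in> ?T" "Poly_Mapping.keys s = Poly_Mapping.keys t"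
      then show "s = t"
        by (intro poly_mapping_eqI) (simp add: squarefree_exponent_lookup)
    qed
    show "Poly_Mapping.keys ` ?T = ?S"
    proof (intro equalityI subsetI)
      fix S assume S: "S \<in> ?S"
      define t :: "'x \<Rightarrow>\<^sub>0 nat" where "t = Abs_poly_mapping (\<lambda>x. if x \<in> S then 1 else 0)"
      have lookup: "Poly_Mapping.lookup t x = (if x \<in> S then 1 else 0)" for x
        by (simp add: t_def)
      have keys: "Poly_Mapping.keys t = S"
        by (auto simp: in_keys_iff lookup split: if_splits)
      have "squarefree_exponent t"
        by (simp add: squarefree_exponent_def lookup)
      moreover have "\<not> e \<preceq> t" if "e \<in> E" for e
        using S that unfolding le[OF sqf[OF that] \<open>squarefree_exponent t\<close>] keys by blast
      ultimately have "t \<in> ?T"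
        using S by (simp add: deg keys)
      then show "S \<in> Poly_Mapping.keys ` ?T"
        using keys by blast
    next
      fix S assume "S \<in> Poly_Mapping.keys ` ?T"
      then obtain t where t: "S = Poly_Mapping.keys t" "squarefree_exponent t"
        "exponent_degree t = j" "\<not> (\<exists>e\<in>E. e \<preceq> t)"
        by blast
      then have "\<not> Poly_Mapping.keys e \<subseteq> S" if "e \<in> E" for e
        using le[OF sqf[OF that] t(2)] that by blast
      then show "S \<in> ?S"
        using t deg by auto
    qed
  qed
  finally show ?thesis
    by (simp add: num_avoiding_def)
qed

theorem theorem2p31:
  fixes I U :: "('x::finite, 'k::field) mpoly set" and m n k :: nat
  assumes "n = CARD('x)"
    and "squarefree_monomial_ideal I"
    and "complete_intersection I"
    and "finite U" and "U \<subseteq> range monom" and "minimally_generates U I" and "card U = m"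
    and "\<And>x. \<exists>u\<in>U. var x dvd u"
    and "k \<le> n - m + 1"
  shows "beta I (n - m + 1) k + beta I (n - m + 1) (n - m + 1 - k) = 0"
proof -
  define E where "E = (monom :: _ \<Rightarrow> ('x, 'k) mpoly) -` U"
  have U: "U = monom ` E"
    using assms(5) by (auto simp: E_def)
  have finE: "finite E"
    unfolding E_def using assms(4) inj_monom by (rule finite_vimageI)
  have gen: "minimally_generates (monom ` E) I"
    using assms(6) by (simp add: U)
  then have I: "I = ideal_generated (monom ` E)"
    by (simp add: minimally_generates_def)
  \<comment> \<open>A generator with empty support is 1, but a regular sequence generates a proper
    ideal.\<close>
  have ne: "Poly_Mapping.keys e \<noteq> {}" if "e \<in> E" for e
  proof
    assume "Poly_Mapping.keys e = {}"
    then have one: "(monom e :: ('x, 'k) mpoly) = 1"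
      by (simp add: monom_def)
    have "p * monom e \<in> ideal_generated (monom ` E)" for p :: "('x, 'k) mpoly"
      unfolding ideal_generated_def by (intro ideal.span_scale ideal.span_base imageI that)
    then have "p \<in> ideal_generated (monom ` E)" for p :: "('x, 'k) mpoly"
      by (simp add: one)
    then have "I = UNIV"
      using I by auto
    then show False
      using assms(3) by (auto simp: complete_intersection_def regular_sequence_def)
  qed
  note disjoint = complete_intersection_disjoint[OF assms(3) gen finE]
  define P where "P = Poly_Mapping.keys ` E"
  \<comment> \<open>Disjoint nonempty supports differ, so there are as many blocks as
    generators.\<close>
  have "inj_on Poly_Mapping.keys E"
    using disjoint ne by (intro inj_onI) (metis inf.idem)
  then have card: "card P = m"
    using assms(7) card_image[OF inj_on_subset[OF inj_monom[where 'k = 'k] subset_UNIV], of E]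
    by (simp add: P_def U card_image)
  have "\<Union>P = UNIV"
  proof (intro equalityI subsetI)
    fix x :: 'x
    obtain e where e: "e \<in> E" "(var x :: ('x, 'k) mpoly) dvd monom e"
      using assms(8) U by blast
    then obtain p :: "('x, 'k) mpoly" where p: "monom e = monom (Poly_Mapping.single x 1) * p"
      by (auto simp: var_def)
    have "Poly_Mapping.lookup (monom (Poly_Mapping.single x 1) * p) e \<noteq> 0"
      unfolding p[symmetric] by (simp add: monom_def)
    then have "Poly_Mapping.lookup (Poly_Mapping.single x 1) x \<le> Poly_Mapping.lookup e x"
      by (rule lookup_monom_times_nonzero[rule_format])
    then have "x \<in> Poly_Mapping.keys e"
      by (simp add: in_keys_iff)
    then show "x \<in> \<Union>P"
      using e by (auto simp: P_def)
  qed simp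
  moreover have "pairwise disjnt P"
    using disjoint by (auto simp: P_def pairwise_def disjnt_def)
  moreover have "{} \<notin> P"
    unfolding P_def using ne by (metis imageE)
  moreover have "alpha I j = num_avoiding P j" for j
    unfolding I P_def using minimally_generates_squarefree[OF gen assms(2)]
    by (intro alpha_eq_num_avoiding)
  ultimately show ?thesis
    using num_avoiding_antisymmetric[of P "n - m + 1" k] assms(1,9)
    by (simp add: beta_def card)
qed

end
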